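(* For $n\ge2$ let $S_n$ be the convex polygon with vertices $\lambda_0,\lambda_1,\dots,\lambda_{n-1},\bar\lambda_{n-2},\dots,\bar\lambda_1$, where $\lambda_k=\frac1n\left(k-\sum_{j=1}^{k}e^{-2j\pi i/n}\right)$. Then, as $n\to\infty$, the boundary of $S_n$ converges to the closed curve made up of the two cycloid arcs $z(\tau)=x(\tau)+i\,y(\tau)$ and $z(\tau)=x(\tau)-i\,y(\tau)$, $\tau\in[0,2\pi]$, where $x(\tau)=\frac{1}{2\pi}(\tau-\sin\tau)$ and $y(\tau)=\frac{1}{2\pi}(1-\cos\tau)$. *)

theory Defs
  imports "HOL-Analysis.Analysis"
begin

definition lam :: "nat \<Rightarrow> nat \<Rightarrow> complex" where
  "lam n k = (1 / of_nat n) *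
     (of_nat k - (\<Sum>j=1..k. exp (- (2 * of_nat j * of_real pi * \<i> / of_nat n))))"

(* For n = 2 the polygon degenerates to the segment from 0 to 1; for n < 2 the value is irrelevant. *)
definition S_polygon :: "nat \<Rightarrow> complex set" where
  "S_polygon n = convex hull (lam n ` {0..n-1} \<union> (\<lambda>k. cnj (lam n k)) ` {1..n-2})"

definition cycloid_x :: "real \<Rightarrow> real" where
  "cycloid_x \<tau> = 1 / (2 * pi) * (\<tau> - sin \<tau>)"

definition cycloid_y :: "real \<Rightarrow> real" where
  "cycloid_y \<tau> = 1 / (2 * pi) * (1 - cos \<tau>)"

definition cycloid_curve :: "complex set" where
  "cycloid_curve =
     (\<lambda>\<tau>. of_real (cycloid_x \<tau>) + \<i> * of_real (cycloid_y \<tau>)) ` {0..2 * pi} \<union>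
     (\<lambda>\<tau>. of_real (cycloid_x \<tau>) - \<i> * of_real (cycloid_y \<tau>)) ` {0..2 * pi}"

(* Real-valued, hence meaningful only for nonempty bounded sets; it is a metric on nonempty compact sets. *)
definition hausdorff_distance :: "'a::metric_space set \<Rightarrow> 'a set \<Rightarrow> real" where
  "hausdorff_distance A B = max (SUP a\<in>A. infdist a B) (SUP b\<in>B. infdist b A)"

end

theory Submission
  imports Defs
begin

text \<open>Nonempty compact convex sets at Hausdorff distance at most \<open>e\<close> have boundaries at Hausdorff
  distance at most \<open>e\<close>. It therefore suffices to compare the polygon with the region enclosed by the
  two cycloid arcs, which is convex because the upper arc lies below its tangents. The vertices
  \<open>lam n k\<close> are right-endpoint Riemann sums for the cycloid, hence lie within \<open>2 pi / n\<close> of the points with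
  parameter \<open>2 pi k / n\<close>, and these points become dense in the arcs.\<close>

section \<open>Hausdorff distance and boundaries of convex sets\<close>

text \<open>The bounds by \<open>e\<close> also keep the images bounded above, so the real-valued
  \<open>SUP\<close> dominates its members and the distance is nonnegative.\<close>

lemma abs_hausdorff_distance_le:
  fixes A B :: "'a::metric_space set"
  assumes "A \<noteq> {}" "B \<noteq> {}"
    and A: "\<And>a. a \<in> A \<Longrightarrow> infdist a B \<le> e"
    and B: "\<And>b. b \<in> B \<Longrightarrow> infdist b A \<le> e"
  shows "\<bar>hausdorff_distance A B\<bar> \<le> e"
proof -
  have "(SUP a\<in>A. infdist a B) \<le> e" "(SUP b\<in>B. infdist b A) \<le> e"
    using assms by (auto intro: cSUP_least)
  moreover have "0 \<le> (SUP a\<in>A. infdist a B)"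
  proof -
    obtain a where "a \<in> A" using assms by blast
    moreover have "bdd_above ((\<lambda>a. infdist a B) ` A)"
      using A by (rule bdd_aboveI2)
    ultimately show ?thesis
      by (meson cSUP_upper infdist_nonneg order_trans)
  qed
  ultimately show ?thesis
    unfolding hausdorff_distance_def by linarith
qed

text \<open>A set with empty interior lies in a hyperplane, whose normal is constant on it.
  Otherwise relative interior and interior agree, so \<open>x\<close> is a relative boundary point
  and has a supporting hyperplane.\<close>

lemma convex_supporting_hyperplane_frontier:
  fixes S :: "'a::euclidean_space set"
  assumes "convex S" "closed S" "x \<in> frontier S"
  obtains u where "norm u = 1" "\<And>y. y \<in> S \<Longrightarrow> u \<bullet> y \<le> u \<bullet> x"
proof -
  have xS: "x \<in> S" and xi: "x \<notin> interior S"
    using assms by (auto simp: frontier_def)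
  have "\<exists>a. a \<noteq> 0 \<and> (\<forall>y\<in>S. a \<bullet> x \<le> a \<bullet> y)"
  proof (cases "interior S = {}")
    case True
    then obtain a b where "a \<noteq> 0" "S \<subseteq> {x. a \<bullet> x = b}"
      using empty_interior_subset_hyperplane[OF \<open>convex S\<close>] by metis
    then have "\<forall>y\<in>S. a \<bullet> x = a \<bullet> y" using xS by auto
    then show ?thesis using \<open>a \<noteq> 0\<close> by (intro exI[of _ a]) simp
  next
    case False
    then have "x \<notin> rel_interior S"
      using xi by (simp add: rel_interior_nonempty_interior)
    then show ?thesis
      using supporting_hyperplane_relative_frontier[OF \<open>convex S\<close>, of x] xS closure_subset
      by (metis subsetD)
  qed
  then obtain a where a: "a \<noteq> 0" "\<And>y. y \<in> S \<Longrightarrow> a \<bullet> x \<le> a \<bullet> y" by blast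
  show thesis
  proof
    \<comment> \<open>\<open>a\<close> points towards \<open>S\<close>; the sign change turns it
      into an outer normal.\<close>
    show "norm (- a /\<^sub>R norm a) = 1" using a by simp
    show "(- a /\<^sub>R norm a) \<bullet> y \<le> (- a /\<^sub>R norm a) \<bullet> x" if "y \<in> S" for y
      using a(2)[OF that] a(1) by (simp add: mult_left_mono)
  qed
qed

text \<open>If a frontier point \<open>a\<close> of \<open>A\<close> lies deeper than \<open>e\<close> inside \<open>B\<close>, then moving from \<open>a\<close> by more
  than \<open>e\<close> along an outer normal of \<open>A\<close> reaches a point of \<open>B\<close> that is too far from \<open>A\<close>.\<close>

lemma infdist_frontier_le:
  fixes A B :: "'a::euclidean_space set"
  assumes A: "convex A" "closed A" and B: "B \<noteq> {}" "bounded B"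
    and AB: "\<And>a. a \<in> A \<Longrightarrow> \<exists>b\<in>B. dist a b \<le> e"
    and BA: "\<And>b. b \<in> B \<Longrightarrow> \<exists>a\<in>A. dist b a \<le> e"
    and a: "a \<in> frontier A"
  shows "infdist a (frontier B) \<le> e"
proof (rule ccontr)
  assume "\<not> ?thesis"
  then have gt: "e < infdist a (frontier B)" by simp
  have aA: "a \<in> A" using a A frontier_subset_closed by blast
  then obtain b where b: "b \<in> B" "dist a b \<le> e" using AB by blast
  have "0 \<le> e" using b(2) zero_le_dist order_trans by blast
  obtain r where r: "e < r" "r < infdist a (frontier B)"
    using gt dense by blast
  \<comment> \<open>A connected ball that meets \<open>B\<close> (in \<open>b\<close>, since
    \<open>e < r\<close>) but not its frontier lies inside \<open>B\<close>.\<close>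
  have "cball a r \<inter> frontier B = {}"
    using r(2) infdist_le[of _ "frontier B" a] by fastforce
  moreover have "b \<in> cball a r \<inter> B" using b r by auto
  ultimately have sub: "cball a r \<subseteq> B"
    using connected_Int_frontier[of "cball a r" B] by fastforce
  obtain u where u: "norm u = 1" "\<And>y. y \<in> A \<Longrightarrow> u \<bullet> y \<le> u \<bullet> a"
    using convex_supporting_hyperplane_frontier[OF A a] by metis
  have "a + r *\<^sub>R u \<in> cball a r"
    using u(1) r \<open>0 \<le> e\<close> by (simp add: dist_norm)
  then obtain c where c: "c \<in> A" "dist (a + r *\<^sub>R u) c \<le> e"
    using sub BA by blast
  have "u \<bullet> u = 1" using u(1) by (simp add: dot_square_norm)
  then have "r \<le> u \<bullet> (a + r *\<^sub>R u - c)"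
    using u(2)[OF c(1)] by (simp add: inner_right_distrib inner_diff_right)
  also have "\<dots> \<le> norm (a + r *\<^sub>R u - c)"
    using norm_cauchy_schwarz[of u "a + r *\<^sub>R u - c"] u(1) by simp
  also have "\<dots> \<le> e" using c(2) by (simp add: dist_norm)
  finally show False using r by simp
qed

lemma abs_hausdorff_distance_frontier_le:
  fixes A B :: "'a::euclidean_space set"
  assumes A: "convex A" "compact A" "A \<noteq> {}" and B: "convex B" "compact B" "B \<noteq> {}"
    and AB: "\<And>a. a \<in> A \<Longrightarrow> \<exists>b\<in>B. dist a b \<le> e"
    and BA: "\<And>b. b \<in> B \<Longrightarrow> \<exists>a\<in>A. dist b a \<le> e"
  shows "\<bar>hausdorff_distance (frontier A) (frontier B)\<bar> \<le> e"
proof (rule abs_hausdorff_distance_le)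
  show "frontier A \<noteq> {}" "frontier B \<noteq> {}"
    using A B compact_imp_bounded not_bounded_UNIV by (metis frontier_not_empty)+
  show "infdist a (frontier B) \<le> e" if "a \<in> frontier A" for a
    using that A B AB BA by (intro infdist_frontier_le[of A B])
      (auto intro: compact_imp_closed compact_imp_bounded)
  show "infdist b (frontier A) \<le> e" if "b \<in> frontier B" for b
    using that A B AB BA by (intro infdist_frontier_le[of B A])
      (auto intro: compact_imp_closed compact_imp_bounded)
qed

text \<open>The points within \<open>e\<close> of \<open>B\<close> form the Minkowski sum
  \<open>?N\<close> of \<open>B\<close> and a ball. It is convex, so it contains the hull of
  \<open>V\<close> once it contains \<open>V\<close>.\<close>

lemma convex_hull_near_convex:
  fixes B :: "'a::real_normed_vector set"
  assumes "convex B" and V: "\<And>v. v \<in> V \<Longrightarrow> \<exists>b\<in>B. dist v b \<le> e"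
    and a: "a \<in> convex hull V"
  shows "\<exists>b\<in>B. dist a b \<le> e"
proof -
  let ?N = "\<Union>x\<in>B. \<Union>y\<in>cball 0 e. {x + y}"
  have iff: "v \<in> ?N \<longleftrightarrow> (\<exists>b\<in>B. dist v b \<le> e)" for v
  proof
    assume "\<exists>b\<in>B. dist v b \<le> e"
    then obtain b where "b \<in> B" "v - b \<in> cball 0 e" by (auto simp: dist_norm norm_minus_commute)
    then show "v \<in> ?N" by force
  next
    assume "v \<in> ?N"
    then obtain b y where "b \<in> B" "norm y \<le> e" "v = b + y" by auto
    then show "\<exists>b\<in>B. dist v b \<le> e" by (intro bexI[of _ b]) (auto simp: dist_norm)
  qed
  have "convex ?N" using \<open>convex B\<close> by (intro convex_sums) auto
  moreover have "V \<subseteq> ?N"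
    using V by (intro subsetI) (simp only: iff)
  ultimately have "convex hull V \<subseteq> ?N" by (simp add: hull_minimal)
  then have "a \<in> ?N" using a by (rule subsetD)
  then show ?thesis by (simp only: iff)
qed

section \<open>The region bounded by the cycloid arcs\<close>

definition cycloid :: "real \<Rightarrow> complex" where
  "cycloid t = Complex (cycloid_x t) (cycloid_y t)"

text \<open>Vertical slices are indexed by the cycloid parameter, which avoids solving for
  \<open>t\<close> in terms of the abscissa.\<close>

definition cycloid_region :: "complex set" where
  "cycloid_region = {z. \<exists>t\<in>{0..2 * pi}. Re z = cycloid_x t \<and> \<bar>Im z\<bar> \<le> cycloid_y t}"

lemma Re_cycloid [simp]: "Re (cycloid t) = cycloid_x t"
  and Im_cycloid [simp]: "Im (cycloid t) = cycloid_y t"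
  by (simp_all add: cycloid_def)

lemma cycloid_x_0 [simp]: "cycloid_x 0 = 0" and cycloid_y_0 [simp]: "cycloid_y 0 = 0"
  and cycloid_x_2pi [simp]: "cycloid_x (2 * pi) = 1" and cycloid_y_2pi [simp]: "cycloid_y (2 * pi) = 0"
  by (simp_all add: cycloid_x_def cycloid_y_def)

lemma cycloid_y_nonneg [simp]: "0 \<le> cycloid_y t"
  by (simp add: cycloid_y_def)

section \<open>The abscissa as a strictly monotone parameter\<close>

lemma one_minus_cos_pos:
  assumes "0 < t" "t < 2 * pi"
  shows "0 < 1 - cos (t::real)"
proof -
  have "0 < sin (t / 2)" using assms by (intro sin_gt_zero) auto
  then show ?thesis using cos_double_sin[of "t / 2"] by simp
qed

lemma continuous_on_cycloid_x: "continuous_on S cycloid_x"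
  unfolding cycloid_x_def by (intro continuous_intros)

text \<open>The derivative is positive only strictly between the cusps, where it vanishes;
  continuity covers the endpoints.\<close>

lemma cycloid_x_less:
  assumes "0 \<le> s" "s < t" "t \<le> 2 * pi"
  shows "cycloid_x s < cycloid_x t"
proof (rule DERIV_pos_imp_increasing_open[OF \<open>s < t\<close>])
  fix x assume "s < x" "x < t"
  then have "0 < 1 - cos x" using assms by (intro one_minus_cos_pos) auto
  moreover have "DERIV cycloid_x x :> 1 / (2 * pi) * (1 - cos x)"
    unfolding cycloid_x_def by (auto intro!: derivative_eq_intros simp: field_simps)
  ultimately show "\<exists>y. DERIV cycloid_x x :> y \<and> 0 < y"
    by (intro exI[of _ "1 / (2 * pi) * (1 - cos x)"]) auto
qed (rule continuous_on_cycloid_x)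

lemma cycloid_x_inj:
  assumes "s \<in> {0..2 * pi}" "t \<in> {0..2 * pi}" "cycloid_x s = cycloid_x t"
  shows "s = t"
  using assms cycloid_x_less[of s t] cycloid_x_less[of t s] by (cases s t rule: linorder_cases) auto

lemma cycloid_x_bounds:
  assumes "t \<in> {0..2 * pi}"
  shows "0 \<le> cycloid_x t" "cycloid_x t \<le> 1"
  using assms cycloid_x_less[of 0 t] cycloid_x_less[of t "2 * pi"]
  by (cases "t = 0"; cases "t = 2 * pi"; force)+

lemma cycloid_x_surj:
  assumes "0 \<le> x" "x \<le> 1"
  obtains t where "t \<in> {0..2 * pi}" "cycloid_x t = x"
  using IVT'[of cycloid_x 0 x "2 * pi"] assms continuous_on_cycloid_x by auto

text \<open>The equation of the tangent is multiplied by \<open>1 - cos t\<close>, the horizontal speed up to a constant,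
  so that it also makes sense at the cusps.\<close>

lemma cycloid_below_tangent:
  assumes s: "s \<in> {0..2 * pi}" and t: "t \<in> {0..2 * pi}"
  shows "cycloid_y s * (1 - cos t) \<le> cycloid_y t * (1 - cos t) + sin t * (cycloid_x s - cycloid_x t)"
proof -
  \<comment> \<open>\<open>g s\<close> is \<open>2 * pi\<close> times the right side minus the left
    side. Since \<open>g t = 0\<close>, it suffices that \<open>g\<close> is minimal at
    \<open>t\<close>.\<close>
  define g where "g s = (1 - cos t) * (cos s - cos t) + sin t * (s - t - sin s + sin t)" for s
  define g' where "g' s = sin t * (1 - cos s) - (1 - cos t) * sin s" for s
  have deriv: "DERIV g x :> g' x" for x
    unfolding g_def g'_def by (auto intro!: derivative_eq_intros simp: algebra_simps)
  \<comment> \<open>The first two sines are nonnegative on \<open>[0, 2 * pi]\<close>, so the sign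
    of \<open>g' x\<close> is governed by that of \<open>x - t\<close>.\<close>
  have g': "g' x = 4 * sin (t / 2) * sin (x / 2) * sin (x / 2 - t / 2)" for x
  proof -
    have "1 - cos t = 2 * (sin (t / 2))\<^sup>2" "1 - cos x = 2 * (sin (x / 2))\<^sup>2"
      using cos_double_sin[of "t / 2"] cos_double_sin[of "x / 2"] by simp_all
    moreover have "sin t = 2 * sin (t / 2) * cos (t / 2)" "sin x = 2 * sin (x / 2) * cos (x / 2)"
      using sin_double[of "t / 2"] sin_double[of "x / 2"] by simp_all
    ultimately show ?thesis
      unfolding g'_def sin_diff by algebra
  qed
  have half: "0 \<le> sin (x / 2)" if "0 \<le> x" "x \<le> 2 * pi" for x
    using that by (intro sin_ge_zero) auto
  have "g t \<le> g s"
  proof (cases "t \<le> s")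
    case True
    then show ?thesis
    proof (rule DERIV_nonneg_imp_nondecreasing)
      fix x assume x: "t \<le> x" "x \<le> s"
      then have "0 \<le> sin (x / 2 - t / 2)"
        using s t by (intro sin_ge_zero) auto
      then have "0 \<le> g' x" using x s t half[of x] half[of t] by (auto simp: g')
      then show "\<exists>y. DERIV g x :> y \<and> 0 \<le> y" using deriv by blast
    qed
  next
    case False
    then have "s \<le> t" by simp
    then show ?thesis
    proof (rule DERIV_nonpos_imp_nonincreasing)
      fix x assume x: "s \<le> x" "x \<le> t"
      then have "0 \<le> sin (t / 2 - x / 2)"
        using s t by (intro sin_ge_zero) auto
      then have "sin (x / 2 - t / 2) \<le> 0"
        using sin_minus[of "t / 2 - x / 2"] by simp
      then have "g' x \<le> 0" using x s t half[of x] half[of t]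
        by (auto simp: g' intro!: mult_nonneg_nonpos)
      then show "\<exists>y. DERIV g x :> y \<and> y \<le> 0" using deriv by blast
    qed
  qed
  then have "0 \<le> 1 / (2 * pi) * g s" by (simp add: g_def)
  also have "\<dots> = cycloid_y t * (1 - cos t) + sin t * (cycloid_x s - cycloid_x t)
      - cycloid_y s * (1 - cos t)"
    unfolding g_def cycloid_x_def cycloid_y_def by (simp only: ring_distribs mult_ac)
  finally show ?thesis by simp
qed

section \<open>Compactness, convexity and boundary of the region\<close>

lemma cycloid_in_region: "t \<in> {0..2 * pi} \<Longrightarrow> cycloid t \<in> cycloid_region"
  by (auto simp: cycloid_region_def)

lemma compact_cycloid_region: "compact cycloid_region"
proof -
  let ?f = "\<lambda>p. Complex (cycloid_x (fst p)) (snd p * cycloid_y (fst p))"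
  have image: "cycloid_region = ?f ` ({0..2 * pi} \<times> {-1..1})"
  proof (intro subset_antisym subsetI)
    fix z assume "z \<in> cycloid_region"
    then obtain t where t: "t \<in> {0..2 * pi}" "Re z = cycloid_x t" "\<bar>Im z\<bar> \<le> cycloid_y t"
      by (auto simp: cycloid_region_def)
    \<comment> \<open>At a cusp the division by zero yields \<open>r = 0\<close>, which is correct
      because \<open>Im z = 0\<close> there.\<close>
    define r where "r = Im z / cycloid_y t"
    have "r \<in> {-1..1}" "r * cycloid_y t = Im z"
      using t(3) cycloid_y_nonneg[of t]
      by (cases "cycloid_y t = 0"; auto simp: r_def field_simps abs_le_iff)+
    then have "z = ?f (t, r)" using t by (simp add: complex_eq_iff)
    then show "z \<in> ?f ` ({0..2 * pi} \<times> {-1..1})"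
      using t \<open>r \<in> {-1..1}\<close> by blast
  next
    fix z assume "z \<in> ?f ` ({0..2 * pi} \<times> {-1..1})"
    then obtain t r where *: "t \<in> {0..2 * pi}" "\<bar>r\<bar> \<le> 1" "z = ?f (t, r)"
      by (elim imageE SigmaE) (auto simp: abs_le_iff)
    then have "\<bar>Im z\<bar> \<le> cycloid_y t"
      by (simp add: abs_mult mult_left_le_one_le)
    then show "z \<in> cycloid_region" using * by (auto simp: cycloid_region_def)
  qed
  have "continuous_on ({0..2 * pi} \<times> {-1..1}) ?f"
    unfolding Complex_eq cycloid_x_def cycloid_y_def by (intro continuous_intros)
  then show ?thesis
    unfolding image by (intro compact_continuous_image compact_Times compact_Icc)
qed

text \<open>Let \<open>t\<close> be the parameter over the abscissa of the convex combination.
  Averaging the tangent inequalities at \<open>t\<close> for both points bounds its height by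
  \<open>cycloid_y t\<close>. At the cusps that inequality is vacuous and a separate argument is
  used.\<close>

lemma convex_cycloid_region: "convex cycloid_region"
proof (rule convexI)
  fix z w :: complex and u v :: real
  assume "z \<in> cycloid_region" "w \<in> cycloid_region" and uv: "0 \<le> u" "0 \<le> v" "u + v = 1"
  then obtain r s where r: "r \<in> {0..2 * pi}" "Re z = cycloid_x r" "\<bar>Im z\<bar> \<le> cycloid_y r"
    and s: "s \<in> {0..2 * pi}" "Re w = cycloid_x s" "\<bar>Im w\<bar> \<le> cycloid_y s"
    by (auto simp: cycloid_region_def)
  define p where "p = u *\<^sub>R z + v *\<^sub>R w"
  have Rep: "Re p = u * cycloid_x r + v * cycloid_x s" using r s by (simp add: p_def)
  have "\<bar>Im p\<bar> \<le> u * \<bar>Im z\<bar> + v * \<bar>Im w\<bar>"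
    using abs_triangle_ineq[of "u * Im z" "v * Im w"] uv by (simp add: p_def abs_mult)
  also have "\<dots> \<le> u * cycloid_y r + v * cycloid_y s"
    using r s uv by (intro add_mono mult_left_mono) auto
  finally have Imp: "\<bar>Im p\<bar> \<le> u * cycloid_y r + v * cycloid_y s" .
  have "0 \<le> Re p"
    using uv r s by (simp add: Rep cycloid_x_bounds)
  moreover have "Re p \<le> 1"
    using uv r s convex_bound_le[of "cycloid_x r" 1 "cycloid_x s" u v]
    by (simp add: Rep cycloid_x_bounds)
  ultimately obtain t where t: "t \<in> {0..2 * pi}" "cycloid_x t = Re p"
    using cycloid_x_surj by metis
  have "\<bar>Im p\<bar> \<le> cycloid_y t"
  proof -
    consider "t = 0" | "t = 2 * pi" | "0 < t" "t < 2 * pi" using t by fastforce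
    then show ?thesis
    proof cases
      case 1
      \<comment> \<open>An extreme abscissa forces every point of nonzero weight to sit at the same
        cusp, where the height is zero.\<close>
      then have "u * cycloid_x r = 0" "v * cycloid_x s = 0"
        using t uv r s Rep cycloid_x_bounds(1)[of r] cycloid_x_bounds(1)[of s]
          mult_nonneg_nonneg[of u "cycloid_x r"] mult_nonneg_nonneg[of v "cycloid_x s"]
        unfolding 1 cycloid_x_0 by linarith+
      then have "u * cycloid_y r = 0" "v * cycloid_y s = 0"
        using cycloid_x_inj[of r 0] cycloid_x_inj[of s 0] r s by auto
      then show ?thesis using Imp cycloid_y_nonneg[of t] by linarith
    next
      case 2
      then have "u * (1 - cycloid_x r) + v * (1 - cycloid_x s) = 0"
        using t(2) Rep uv(3) unfolding right_diff_distrib 2 cycloid_x_2pi by simp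
      then have "u * (1 - cycloid_x r) = 0" "v * (1 - cycloid_x s) = 0"
        using uv r s cycloid_x_bounds(2)[of r] cycloid_x_bounds(2)[of s]
          mult_nonneg_nonneg[of u "1 - cycloid_x r"] mult_nonneg_nonneg[of v "1 - cycloid_x s"]
        by linarith+
      then have "u * cycloid_y r = 0" "v * cycloid_y s = 0"
        using cycloid_x_inj[of r "2 * pi"] cycloid_x_inj[of s "2 * pi"] r s by auto
      then show ?thesis using Imp cycloid_y_nonneg[of t] by linarith
    next
      case 3
      have "(u * cycloid_y r + v * cycloid_y s) * (1 - cos t)
          = u * (cycloid_y r * (1 - cos t)) + v * (cycloid_y s * (1 - cos t))"
        by (simp add: algebra_simps)
      also have "\<dots> \<le> u * (cycloid_y t * (1 - cos t) + sin t * (cycloid_x r - cycloid_x t))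
          + v * (cycloid_y t * (1 - cos t) + sin t * (cycloid_x s - cycloid_x t))"
        using uv r s t by (intro add_mono mult_left_mono cycloid_below_tangent) auto
      \<comment> \<open>The slope term vanishes because the averaged abscissa is
        \<open>cycloid_x t\<close>.\<close>
      also have "\<dots> = (u + v) * (cycloid_y t * (1 - cos t))
          + sin t * (u * cycloid_x r + v * cycloid_x s - (u + v) * cycloid_x t)"
        by (simp add: algebra_simps)
      also have "\<dots> = cycloid_y t * (1 - cos t)" using t Rep uv by simp
      finally have "u * cycloid_y r + v * cycloid_y s \<le> cycloid_y t"
        using one_minus_cos_pos[OF 3] by simp
      then show ?thesis using Imp by simp
    qed
  qed
  then show "u *\<^sub>R z + v *\<^sub>R w \<in> cycloid_region"
    unfolding cycloid_region_def p_def[symmetric] using t by (intro CollectI bexI[of _ t]) auto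
qed

lemma cycloid_curve_eq:
  "cycloid_curve = {z. \<exists>t\<in>{0..2 * pi}. Re z = cycloid_x t \<and> \<bar>Im z\<bar> = cycloid_y t}"
proof -
  have "z = of_real (cycloid_x t) + \<i> * of_real (cycloid_y t) \<or>
      z = of_real (cycloid_x t) - \<i> * of_real (cycloid_y t) \<longleftrightarrow>
      Re z = cycloid_x t \<and> \<bar>Im z\<bar> = cycloid_y t" for z t
    using cycloid_y_nonneg[of t] by (auto simp: complex_eq_iff abs_eq_iff')
  then show ?thesis unfolding cycloid_curve_def by blast
qed

text \<open>At a frontier point strictly between the arcs, the region points directly above and
  below force an outer normal to be horizontal, and the cusps 0 and 1 to its left and right force it
  to be zero. Conversely, moving a curve point vertically away from the real axis leaves the
  region.\<close>

lemma frontier_cycloid_region: "frontier cycloid_region = cycloid_curve"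
proof (intro subset_antisym subsetI)
  fix z assume z: "z \<in> frontier cycloid_region"
  have closed: "closed cycloid_region" using compact_cycloid_region compact_imp_closed by blast
  then have "z \<in> cycloid_region" using z frontier_subset_closed by blast
  then obtain t where t: "t \<in> {0..2 * pi}" "Re z = cycloid_x t" "\<bar>Im z\<bar> \<le> cycloid_y t"
    by (auto simp: cycloid_region_def)
  have "\<bar>Im z\<bar> = cycloid_y t"
  proof (rule ccontr)
    assume "\<bar>Im z\<bar> \<noteq> cycloid_y t"
    then have less: "\<bar>Im z\<bar> < cycloid_y t" using t by simp
    then have "t \<noteq> 0" "t \<noteq> 2 * pi" by auto
    then have Re: "0 < Re z" "Re z < 1"
      using t cycloid_x_less[of 0 t] cycloid_x_less[of t "2 * pi"] by auto
    obtain u where u: "norm u = 1" "\<And>w. w \<in> cycloid_region \<Longrightarrow> u \<bullet> w \<le> u \<bullet> z"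
      using convex_supporting_hyperplane_frontier[OF convex_cycloid_region closed z] by metis
    have u': "Re u * Re w + Im u * Im w \<le> Re u * Re z + Im u * Im z" if "w \<in> cycloid_region" for w
      using u(2)[OF that] by (simp add: inner_complex_def)
    have "Complex (Re z) (cycloid_y t) \<in> cycloid_region" "Complex (Re z) (- cycloid_y t) \<in> cycloid_region"
      using t by (auto simp: cycloid_region_def)
    then have "Im u * (cycloid_y t - Im z) \<le> 0" "0 \<le> Im u * (cycloid_y t + Im z)"
      using u' by (force simp: algebra_simps)+
    moreover have "0 < cycloid_y t - Im z" "0 < cycloid_y t + Im z" using less by auto
    ultimately have Im0: "Im u = 0"
      by (meson mult_le_0_iff zero_le_mult_iff order_antisym not_less)
    have "0 \<in> cycloid_region" "1 \<in> cycloid_region"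
      using cycloid_in_region[of 0] cycloid_in_region[of "2 * pi"]
      by (auto simp: cycloid_def Complex_eq)
    then have "0 \<le> Re u * Re z" "Re u * (1 - Re z) \<le> 0"
      using u'[of 0] u'[of 1] Im0 by (auto simp: algebra_simps)
    then have "Re u = 0" using Re
      by (meson diff_gt_0_iff_gt mult_le_0_iff zero_le_mult_iff order_antisym not_less)
    then show False using Im0 u(1) by (simp add: norm_complex_def)
  qed
  then show "z \<in> cycloid_curve" using t by (auto simp: cycloid_curve_eq)
next
  fix z assume "z \<in> cycloid_curve"
  then obtain t where t: "t \<in> {0..2 * pi}" "Re z = cycloid_x t" "\<bar>Im z\<bar> = cycloid_y t"
    by (auto simp: cycloid_curve_eq)
  have "z \<in> cycloid_region" using t by (auto simp: cycloid_region_def)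
  moreover have "z \<notin> interior cycloid_region"
  proof
    assume "z \<in> interior cycloid_region"
    then obtain e where e: "0 < e" "cball z e \<subseteq> cycloid_region"
      by (auto simp: mem_interior_cball)
    \<comment> \<open>The sign of \<open>s\<close> makes
      \<open>\<bar>Im z + s\<bar> = \<bar>Im z\<bar> + e\<close>, while the abscissa and hence the
      parameter stay fixed.\<close>
    define s where "s = (if 0 \<le> Im z then e else - e)"
    have "z + \<i> * of_real s \<in> cycloid_region"
      using e by (intro subsetD[OF e(2)]) (auto simp: dist_norm norm_mult s_def)
    then obtain r where r: "r \<in> {0..2 * pi}" "cycloid_x t = cycloid_x r" "\<bar>Im z + s\<bar> \<le> cycloid_y r"
      using t by (auto simp: cycloid_region_def)
    then have "r = t" using cycloid_x_inj t by metis
    then show False using r t e by (auto simp: s_def split: if_splits)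
  qed
  ultimately show "z \<in> frontier cycloid_region"
    using closure_subset by (auto simp: frontier_def)
qed

section \<open>The polygon vertices approximate the cycloid\<close>

lemma norm_exp_imaginary_Taylor: "norm (exp (\<i> * of_real h) - 1 - \<i> * of_real h) \<le> h\<^sup>2"
  using Taylor_exp[of "\<i> * of_real h" 1] by (simp add: norm_mult power2_eq_square diff_diff_eq)

text \<open>Since \<open>sin t + \<i> * cos t = \<i> * exp (- \<i> * t)\<close>, the curve is
  expressed through the same exponentials as \<open>lam\<close>.\<close>

lemma cycloid_exp: "cycloid t = (of_real t + \<i> - \<i> * exp (- (\<i> * of_real t))) / of_real (2 * pi)"
proof -
  have "exp (- (\<i> * of_real t)) = Complex (cos t) (- sin t)"
    using cis_conv_exp[of "- t"] by (simp add: complex_eq_iff)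
  then show ?thesis
    by (simp add: complex_eq_iff cycloid_x_def cycloid_y_def del: of_real_mult)
qed

lemma lam_Suc:
  "lam n (Suc k) = lam n k + (1 - exp (- (\<i> * of_real (2 * pi * real (Suc k) / real n)))) / of_nat n"
  by (simp add: lam_def algebra_simps add_divide_distrib diff_divide_distrib)

text \<open>This is the error of the right-endpoint rule for the integral over \<open>[t - h, t]\<close> of the derivative
  \<open>(1 - exp (- \<i> t)) / (2 pi)\<close> of the cycloid.\<close>

lemma cycloid_step:
  "norm (cycloid t - cycloid (t - h) - of_real h / of_real (2 * pi) * (1 - exp (- (\<i> * of_real t)))) \<le> h\<^sup>2 / (2 * pi)"
proof -
  have *: "exp (- (\<i> * of_real (t - h))) = exp (- (\<i> * of_real t)) * exp (\<i> * of_real h)"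
    by (simp add: exp_add[symmetric] algebra_simps)
  have "cycloid t - cycloid (t - h) - of_real h / of_real (2 * pi) * (1 - exp (- (\<i> * of_real t)))
      = \<i> * exp (- (\<i> * of_real t)) * (exp (\<i> * of_real h) - 1 - \<i> * of_real h) / of_real (2 * pi)"
    unfolding cycloid_exp * by (simp add: field_simps)
  also have "norm \<dots> = norm (exp (\<i> * of_real h) - 1 - \<i> * of_real h) / (2 * pi)"
    using norm_exp_i_times[of "- t"] by (simp add: norm_mult norm_divide)
  also have "\<dots> \<le> h\<^sup>2 / (2 * pi)"
    using norm_exp_imaginary_Taylor by (simp add: divide_right_mono)
  finally show ?thesis .
qed

text \<open>Both sequences start at 0, and each step of length \<open>2 * pi / n\<close> adds at
  most the quadrature error of \<open>cycloid_step\<close>.\<close>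

lemma lam_near_cycloid_aux:
  "norm (cycloid (2 * pi * real k / real n) - lam n k) \<le> real k * ((2 * pi / real n)\<^sup>2 / (2 * pi))"
proof (induction k)
  case 0
  then show ?case by (simp add: lam_def cycloid_def Complex_eq)
next
  case (Suc k)
  let ?h = "2 * pi / real n" and ?t = "2 * pi * real (Suc k) / real n"
  have h: "of_real ?h / of_real (2 * pi) = (1 / of_nat n :: complex)" by simp
  have t: "?t - ?h = 2 * pi * real k / real n"
    unfolding of_nat_Suc by (simp add: algebra_simps add_divide_distrib)
  have "norm (cycloid ?t - lam n (Suc k))
      = norm ((cycloid (2 * pi * real k / real n) - lam n k) +
          (cycloid ?t - cycloid (?t - ?h) - of_real ?h / of_real (2 * pi) * (1 - exp (- (\<i> * of_real ?t)))))"
    unfolding lam_Suc h t by (simp add: diff_diff_eq add.commute)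
  also have "\<dots> \<le> real k * (?h\<^sup>2 / (2 * pi)) + ?h\<^sup>2 / (2 * pi)"
    by (rule norm_triangle_le[OF add_mono[OF Suc cycloid_step]])
  also have "\<dots> = real (Suc k) * (?h\<^sup>2 / (2 * pi))"
    unfolding of_nat_Suc distrib_right by simp
  finally show ?case .
qed

lemma lam_near_cycloid:
  assumes "0 < n" "k \<le> n"
  shows "dist (lam n k) (cycloid (2 * pi * real k / real n)) \<le> 2 * pi / real n"
proof -
  have "real k * ((2 * pi / real n)\<^sup>2 / (2 * pi)) \<le> real n * ((2 * pi / real n)\<^sup>2 / (2 * pi))"
    using assms by (intro mult_right_mono) auto
  also have "\<dots> = 2 * pi / real n" using assms by (simp add: field_simps power2_eq_square)
  finally show ?thesis
    using lam_near_cycloid_aux[of k n] by (simp add: dist_norm norm_minus_commute)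
qed

text \<open>The coordinates contribute at most \<open>2 * \<bar>s - t\<bar>\<close> and
  \<open>\<bar>s - t\<bar>\<close>, both over \<open>2 * pi\<close>, and
  \<open>3 < 2 * pi\<close>.\<close>

lemma cycloid_lipschitz: "dist (cycloid s) (cycloid t) \<le> \<bar>s - t\<bar>"
proof -
  have sin: "\<bar>sin ((s - t) / 2)\<bar> \<le> \<bar>s - t\<bar> / 2"
    using abs_sin_x_le_abs_x[of "(s - t) / 2"] by simp
  have "\<bar>sin s - sin t\<bar> = 2 * (\<bar>sin ((s - t) / 2)\<bar> * \<bar>cos ((s + t) / 2)\<bar>)"
    unfolding sin_diff_sin by (simp add: abs_mult)
  also have "\<dots> \<le> 2 * (\<bar>sin ((s - t) / 2)\<bar> * 1)"
    by (intro mult_left_mono) auto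
  finally have 1: "\<bar>sin s - sin t\<bar> \<le> \<bar>s - t\<bar>" using sin by simp
  have "\<bar>cos t - cos s\<bar> = 2 * (\<bar>sin ((s - t) / 2)\<bar> * \<bar>sin ((t + s) / 2)\<bar>)"
    unfolding cos_diff_cos by (simp add: abs_mult)
  also have "\<dots> \<le> 2 * (\<bar>sin ((s - t) / 2)\<bar> * 1)"
    by (intro mult_left_mono) auto
  finally have 2: "\<bar>cos t - cos s\<bar> \<le> \<bar>s - t\<bar>" using sin by simp
  have "dist (cycloid s) (cycloid t) \<le> \<bar>cycloid_x s - cycloid_x t\<bar> + \<bar>cycloid_y s - cycloid_y t\<bar>"
    using cmod_le[of "cycloid s - cycloid t"] by (simp add: dist_norm)
  also have "\<dots> = (\<bar>(s - t) - (sin s - sin t)\<bar> + \<bar>cos t - cos s\<bar>) / (2 * pi)"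
    by (simp add: cycloid_x_def cycloid_y_def diff_divide_distrib[symmetric] add_divide_distrib
        algebra_simps)
  also have "\<dots> \<le> (3 * \<bar>s - t\<bar>) / (2 * pi)"
    using 1 2 abs_triangle_ineq4[of "s - t" "sin s - sin t"] by (intro divide_right_mono) simp_all
  also have "\<dots> \<le> \<bar>s - t\<bar>"
    using pi_gt3 mult_right_mono[of 3 "2 * pi" "\<bar>s - t\<bar>"] by (simp add: field_simps)
  finally show ?thesis .
qed

text \<open>Restricting to \<open>1 \<le> k \<le> n - 2\<close> guarantees that \<open>lam n k\<close> and its conjugate are both vertices.\<close>

lemma cycloid_near_lam:
  assumes n: "3 \<le> n" and t: "t \<in> {0..2 * pi}"
  obtains k where "k \<in> {1..n - 2}" "dist (cycloid t) (lam n k) \<le> 6 * pi / real n"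
proof -
  define m where "m = nat \<lfloor>t * real n / (2 * pi)\<rfloor>"
  have q: "0 \<le> t * real n / (2 * pi)" "t * real n / (2 * pi) \<le> real n"
    using t n by (auto simp: field_simps)
  have m: "real m \<le> t * real n / (2 * pi)" "t * real n / (2 * pi) \<le> real m + 1" "m \<le> n"
    using q unfolding m_def by linarith+
  \<comment> \<open>Clamping \<open>m\<close> into \<open>{1..n - 2}\<close> keeps the index within
    2 of the exact quotient, the worst case being \<open>m = n\<close> or \<open>m = n - 1\<close>.
    Two steps cost \<open>4 * pi / n\<close>, and the vertex error adds
    \<open>2 * pi / n\<close>.\<close>
  define k where "k = max 1 (min m (n - 2))"
  have k: "k \<in> {1..n - 2}" using n by (auto simp: k_def)
  have "\<bar>t * real n / (2 * pi) - real k\<bar> \<le> 2"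
    using m q n unfolding k_def by (auto simp: max_def min_def split: if_splits)
  then have "\<bar>t * real n / (2 * pi) - real k\<bar> * (2 * pi / real n) \<le> 2 * (2 * pi / real n)"
    by (intro mult_right_mono) auto
  moreover have "t - 2 * pi * real k / real n = (t * real n / (2 * pi) - real k) * (2 * pi / real n)"
    using n by (simp add: field_simps)
  ultimately have "\<bar>t - 2 * pi * real k / real n\<bar> \<le> 4 * pi / real n"
    by (simp add: abs_mult)
  then have "dist (cycloid t) (cycloid (2 * pi * real k / real n)) \<le> 4 * pi / real n"
    using cycloid_lipschitz order_trans by blast
  moreover have "dist (lam n k) (cycloid (2 * pi * real k / real n)) \<le> 2 * pi / real n"
    using k n by (intro lam_near_cycloid) auto
  ultimately have "dist (cycloid t) (lam n k) \<le> 4 * pi / real n + 2 * pi / real n"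
    by (meson add_mono dist_triangle2 order_trans)
  then show thesis using that k by (simp add: add_divide_distrib[symmetric])
qed

section \<open>Mutual approximation of polygon and region\<close>

lemma dist_cnj: "dist (cnj z) (cnj w) = dist z w"
  by (metis complex_cnj_diff complex_mod_cnj dist_norm)

lemma cnj_in_cycloid_region: "z \<in> cycloid_region \<Longrightarrow> cnj z \<in> cycloid_region"
  by (auto simp: cycloid_region_def)

lemma S_polygon_near_region:
  assumes n: "3 \<le> n" and a: "a \<in> S_polygon n"
  shows "\<exists>b\<in>cycloid_region. dist a b \<le> 6 * pi / real n"
proof (rule convex_hull_near_convex[OF convex_cycloid_region _ a[unfolded S_polygon_def]])
  have *: "\<exists>b\<in>cycloid_region. dist (lam n k) b \<le> 6 * pi / real n" if "k \<le> n" for k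
  proof
    show "cycloid (2 * pi * real k / real n) \<in> cycloid_region"
      using n that by (intro cycloid_in_region) (auto simp: field_simps)
    have "2 * pi / real n \<le> 6 * pi / real n" by (intro divide_right_mono) auto
    then show "dist (lam n k) (cycloid (2 * pi * real k / real n)) \<le> 6 * pi / real n"
      using lam_near_cycloid[of n k] n that by linarith
  qed
  fix v assume "v \<in> lam n ` {0..n - 1} \<union> (\<lambda>k. cnj (lam n k)) ` {1..n - 2}"
  then obtain k where k: "k \<le> n" "v = lam n k \<or> v = cnj (lam n k)"
    by (metis (no_types, lifting) UnE atLeastAtMost_iff diff_le_self imageE order_trans)
  obtain b where "b \<in> cycloid_region" "dist (lam n k) b \<le> 6 * pi / real n"
    using * k by blast
  then show "\<exists>b\<in>cycloid_region. dist v b \<le> 6 * pi / real n"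
    using k(2) cnj_in_cycloid_region dist_cnj by metis
qed

text \<open>Each point of the region lies on a vertical chord between two conjugate arc points, both
  close to vertices; convexity of the polygon extends this to the chord.\<close>

lemma region_near_S_polygon:
  assumes n: "3 \<le> n" and b: "b \<in> cycloid_region"
  shows "\<exists>a\<in>S_polygon n. dist b a \<le> 6 * pi / real n"
proof -
  obtain t where t: "t \<in> {0..2 * pi}" "Re b = cycloid_x t" "\<bar>Im b\<bar> \<le> cycloid_y t"
    using b by (auto simp: cycloid_region_def)
  obtain k where k: "k \<in> {1..n - 2}" "dist (cycloid t) (lam n k) \<le> 6 * pi / real n"
    using cycloid_near_lam[OF n t(1)] by blast
  have "lam n k \<in> S_polygon n" "cnj (lam n k) \<in> S_polygon n"
    unfolding S_polygon_def using k(1) by (auto intro!: hull_inc)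
  then have near: "\<exists>a\<in>S_polygon n. dist v a \<le> 6 * pi / real n" if "v \<in> {cycloid t, cnj (cycloid t)}" for v
    using that k(2) dist_cnj by (metis empty_iff insert_iff)
  have "b \<in> convex hull {cycloid t, cnj (cycloid t)}"
  proof -
    \<comment> \<open>The weight solves \<open>Im b = (2 * u - 1) * cycloid_y t\<close>; at a cusp
      the chord is a single point and any weight would do.\<close>
    define u where "u = (if cycloid_y t = 0 then 1 else (cycloid_y t + Im b) / (2 * cycloid_y t))"
    have "b = u *\<^sub>R cycloid t + (1 - u) *\<^sub>R cnj (cycloid t)" "0 \<le> u" "0 \<le> 1 - u"
      using t(2,3) cycloid_y_nonneg[of t]
      by (auto simp: u_def complex_eq_iff field_simps abs_le_iff)
    then show ?thesis
      unfolding convex_hull_2 by (intro CollectI exI[of _ u] exI[of _ "1 - u"]) simp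
  qed
  moreover have "convex (S_polygon n)" by (simp add: S_polygon_def)
  ultimately show ?thesis using near convex_hull_near_convex by blast
qed

theorem theorem7:
  shows "(\<lambda>n. hausdorff_distance (frontier (S_polygon n)) cycloid_curve) \<longlonglongrightarrow> 0"
proof (rule Lim_null_comparison)
  have "\<bar>hausdorff_distance (frontier (S_polygon n)) cycloid_curve\<bar> \<le> 6 * pi / real n"
    if "3 \<le> n" for n
    \<comment> \<open>Reading the curve as the frontier of a convex region makes the comparison of
      boundaries applicable.\<close>
    unfolding frontier_cycloid_region[symmetric]
  proof (rule abs_hausdorff_distance_frontier_le)
    show "convex (S_polygon n)" by (simp add: S_polygon_def)
    show "compact (S_polygon n)"
      unfolding S_polygon_def by (intro finite_imp_compact_convex_hull) auto
    show "S_polygon n \<noteq> {}" by (auto simp: S_polygon_def)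
    show "cycloid_region \<noteq> {}" using cycloid_in_region[of 0] by auto
  qed (use that S_polygon_near_region region_near_S_polygon convex_cycloid_region
      compact_cycloid_region in auto)
  then show "\<forall>\<^sub>F n in sequentially.
      norm (hausdorff_distance (frontier (S_polygon n)) cycloid_curve) \<le> 6 * pi / real n"
    using eventually_sequentially by auto
  show "(\<lambda>n. 6 * pi / real n) \<longlonglongrightarrow> 0"
    by (rule lim_const_over_n)
qed

end
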